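(* Let $\alpha\in(0,1)$, $U=\prod_{i=1}^d[0,b_i]\subset\mathbb{R}^d$ with all $b_i>0$, and $p\in U$. For each $i\in\{1,\dots,d\}$, the unique normalized $i$-th fractional derivation of order $\alpha$ at $p$ is the functional $(\partial_{C,i}^\alpha)|_p:\mathcal{A}_i^\alpha(U)\to\mathbb{R}$, $f\mapsto(\partial_{C,i}^\alpha f)(p)$.
   Context: Fix $\alpha\in(0,1)$, a rectangle $U=\prod_{i=1}^d[0,b_i]$, $b_i>0$, and a base point $p\in U$. For $f\in C(U)$ (real-valued continuous functions) the left Riemann--Liouville integral of order $\alpha$ in the $i$-th variable is $$(I_i^\alpha f)(x)=\frac{1}{\Gamma(\alpha)}\int_0^{x_i}(x_i-\xi)^{\alpha-1}f(x_1,\dots,x_{i-1},\xi,x_{i+1},\dots,x_d)\,d\xi.$$ Define $\mathcal{A}_i^\alpha(U)=\{f\in C(U):\exists h_i\in C(U),\ f=I_i^\alpha h_i\}$, a real vector space. For $f\in\mathcal{A}_i^\alpha(U)$ the function $h_i\in C(U)$ with $f=I_i^\alpha h_i$ is unique, and the coordinatewise anchored Caputo derivative is defined by $\partial_{C,i}^\alpha f:=h_i\in C(U)$. An $i$-th fractional derivation of order $\alpha$ at $p$ is a linear map $D_i:\mathcal{A}_i^\alpha(U)\to\mathbb{R}$ for which there exists a scalar $\lambda_i(D_i)\in\mathbb{R}$ with $D_i(I_i^\alpha h)=\lambda_i(D_i)\,h(p)$ for every $h\in C(U)$; this scalar is uniquely determined (it equals $D_i(I_i^\alpha 1)$). $D_i$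 is called normalized if $\lambda_i(D_i)=1$. *)

theory Defs
  imports "HOL-Analysis.Analysis"
begin

text \<open>
  Throughout, the rectangle \<open>U\<close> is \<^term>\<open>cbox 0 b :: (real ^ 'd) set\<close>. A real-valued function on
  \<open>U\<close> is represented by its extension by zero to \<open>real ^ 'd\<close>; thus equality in \<open>C(U)\<close> is equality
  of HOL functions, and \<open>C(U)\<close> is closed under pointwise linear combinations.
\<close>

definition cont_fun :: "(real ^ 'd) set \<Rightarrow> (real ^ 'd \<Rightarrow> real) set" where
  "cont_fun U = {f. continuous_on U f \<and> (\<forall>x. x \<notin> U \<longrightarrow> f x = 0)}"

text \<open>
  The value \<open>0 powr (\<alpha> - 1) = 0\<close> at the end point \<open>\<xi> = x $ i\<close> is irrelevant to the integral.
\<close>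

definition RL_integral ::
  "real \<Rightarrow> real ^ 'd \<Rightarrow> 'd \<Rightarrow> (real ^ 'd \<Rightarrow> real) \<Rightarrow> real ^ 'd \<Rightarrow> real" where
  "RL_integral \<alpha> b i f x =
     (if x \<in> cbox 0 b
      then 1 / Gamma \<alpha> *
           (LINT \<xi>:{0..x $ i}|lborel.
              (x $ i - \<xi>) powr (\<alpha> - 1) * f (\<chi> j. if j = i then \<xi> else x $ j))
      else 0)"

definition frac_space :: "real \<Rightarrow> real ^ 'd \<Rightarrow> 'd \<Rightarrow> (real ^ 'd \<Rightarrow> real) set" where
  "frac_space \<alpha> b i =
     {f \<in> cont_fun (cbox 0 b). \<exists>h \<in> cont_fun (cbox 0 b). f = RL_integral \<alpha> b i h}"

definition caputo ::
  "real \<Rightarrow> real ^ 'd \<Rightarrow> 'd \<Rightarrow> (real ^ 'd \<Rightarrow> real) \<Rightarrow> real ^ 'd \<Rightarrow> real" where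
  "caputo \<alpha> b i f = (THE h. h \<in> cont_fun (cbox 0 b) \<and> f = RL_integral \<alpha> b i h)"

text \<open>
  A functional with domain \<open>A\<close> is an element of \<^term>\<open>extensional A\<close>, so that two such
  functionals are equal iff they agree on \<open>A\<close>.
\<close>

definition linear_functional_on ::
  "(real ^ 'd \<Rightarrow> real) set \<Rightarrow> ((real ^ 'd \<Rightarrow> real) \<Rightarrow> real) \<Rightarrow> bool" where
  "linear_functional_on A D \<longleftrightarrow>
     D \<in> extensional A \<and>
     (\<forall>f\<in>A. \<forall>g\<in>A. D (\<lambda>x. f x + g x) = D f + D g) \<and>
     (\<forall>c. \<forall>f\<in>A. D (\<lambda>x. c * f x) = c * D f)"

definition frac_derivation ::
  "real \<Rightarrow> real ^ 'd \<Rightarrow> 'd \<Rightarrow> real ^ 'd \<Rightarrow> ((real ^ 'd \<Rightarrow> real) \<Rightarrow> real) \<Rightarrow> bool" where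
  "frac_derivation \<alpha> b i p D \<longleftrightarrow>
     linear_functional_on (frac_space \<alpha> b i) D \<and>
     (\<exists>c. \<forall>h \<in> cont_fun (cbox 0 b). D (RL_integral \<alpha> b i h) = c * h p)"

definition frac_scalar ::
  "real \<Rightarrow> real ^ 'd \<Rightarrow> 'd \<Rightarrow> real ^ 'd \<Rightarrow> ((real ^ 'd \<Rightarrow> real) \<Rightarrow> real) \<Rightarrow> real" where
  "frac_scalar \<alpha> b i p D =
     (THE c. \<forall>h \<in> cont_fun (cbox 0 b). D (RL_integral \<alpha> b i h) = c * h p)"

definition normalized_frac_derivation ::
  "real \<Rightarrow> real ^ 'd \<Rightarrow> 'd \<Rightarrow> real ^ 'd \<Rightarrow> ((real ^ 'd \<Rightarrow> real) \<Rightarrow> real) \<Rightarrow> bool" where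
  "normalized_frac_derivation \<alpha> b i p D \<longleftrightarrow>
     frac_derivation \<alpha> b i p D \<and> frac_scalar \<alpha> b i p D = 1"

end

theory Submission
  imports Defs
begin

text \<open>
  Everything rests on three properties of the operator \<open>h \<mapsto> I\<^sub>i\<^sup>\<alpha> h\<close> on \<open>C(U)\<close>: it is linear,
  it maps \<open>C(U)\<close> into \<open>C(U)\<close>, and it is injective. Given these, it is a linear bijection from
  \<open>C(U)\<close> onto the fractional space, the Caputo derivative is its inverse, and the condition
  \<open>D (I\<^sub>i\<^sup>\<alpha> h) = h p\<close> prescribes a normalized derivation on its whole domain. The constant
  function \<open>1\<close> on \<open>U\<close> shows that the scalar of a derivation is unique.

  For linearity and continuity the integral is rescaled to the unit interval: with
  \<open>\<xi> = x\<^sub>i s\<close>,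
  \<open>I\<^sub>i\<^sup>\<alpha> h (x) = x\<^sub>i\<^sup>\<alpha> / \<Gamma>(\<alpha>) \<cdot> \<integral>\<^sub>0\<^sup>1 (1 - s)\<^sup>\<alpha>\<^sup>-\<^sup>1 h(x\<^sub>1, \<dots>, x\<^sub>i s, \<dots>, x\<^sub>d) ds\<close>.
  The singular weight is now an integrable function that does not depend on \<open>x\<close>, and dominated
  convergence applies (\<open>continuous_on_weighted_integral\<close>).

  Injectivity is Abel's classical argument in one variable (\<open>Abel_operator_injective\<close>). If
  \<open>\<integral>\<^sub>0\<^sup>x (x - t)\<^sup>\<alpha>\<^sup>-\<^sup>1 g(t) dt = 0\<close> for all \<open>x\<close>, multiply by \<open>(y - x)\<^sup>-\<^sup>\<alpha>\<close>, integrate over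
  \<open>x \<in> [0, y]\<close> and exchange the integrals. The inner integral becomes
  \<open>\<integral>\<^sub>t\<^sup>y (y - x)\<^sup>-\<^sup>\<alpha> (x - t)\<^sup>\<alpha>\<^sup>-\<^sup>1 dx = B(\<alpha>, 1 - \<alpha>)\<close>, which is a nonzero constant; so
  \<open>\<integral>\<^sub>0\<^sup>y g = 0\<close> for all \<open>y\<close>, and \<open>g = 0\<close> by differentiation.
\<close>

section \<open>The Beta kernel on an interval\<close>

lemma has_bochner_integral_Beta:
  fixes a c :: real
  assumes "0 < a" "0 < c"
  shows "has_bochner_integral lborel
           (\<lambda>s. indicator {0..1} s * (s powr (a - 1) * (1 - s) powr (c - 1))) (Beta a c)"
proof -
  let ?f = "\<lambda>s::real. s powr (a - 1) * (1 - s) powr (c - 1)"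
  have I: "(?f has_integral Beta a c) {0..1}"
    by (rule has_integral_Beta_real[OF assms])
  have "?f absolutely_integrable_on {0..1}"
    using I by (intro nonnegative_absolutely_integrable_1) (auto simp: has_integral_integrable)
  then have int: "set_integrable lborel {0..1} ?f"
    unfolding set_integrable_def by (subst (asm) integrable_completion) auto
  have "(LINT s:{0..1}|lborel. ?f s) = Beta a c"
    using set_borel_integral_eq_integral(2)[OF int] I by (simp add: integral_unique)
  with int show ?thesis
    by (simp add: has_bochner_integral_iff set_integrable_def set_lebesgue_integral_def)
qed

text \<open>
  The exponents \<open>-\<alpha>\<close> and \<open>\<alpha> - 1\<close> add up to \<open>-1\<close>, so the affine change of variables
  \<open>x = t + (y - t) s\<close> removes every trace of \<open>t\<close> and \<open>y\<close>. This independence is what makes the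
  fractional kernels of orders \<open>\<alpha>\<close> and \<open>1 - \<alpha>\<close> compose to the ordinary integral.
\<close>

lemma has_bochner_integral_Abel_kernels:
  fixes \<alpha> t y :: real
  assumes "0 < \<alpha>" "\<alpha> < 1" "t < y"
  shows "has_bochner_integral lborel
           (\<lambda>x. indicator {t..y} x * ((y - x) powr (-\<alpha>) * (x - t) powr (\<alpha> - 1)))
           (Beta \<alpha> (1 - \<alpha>))"
proof -
  let ?F = "\<lambda>x. indicator {t..y} x * ((y - x) powr (-\<alpha>) * (x - t) powr (\<alpha> - 1))"
  have eq: "?F (t + (y - t) * s)
      = inverse (y - t) * (indicator {0..1} s * (s powr (\<alpha> - 1) * (1 - s) powr (1 - \<alpha> - 1)))"
    for s
  proof (cases "s \<in> {0..1}")
    case True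
    have "y - (t + (y - t) * s) = (y - t) * (1 - s)" by (simp add: algebra_simps)
    moreover have "(y - t) * s \<le> y - t"
      using True assms by (intro mult_left_le) auto
    then have "t + (y - t) * s \<le> y" by linarith
    moreover have "(y - t) powr (-\<alpha>) * (y - t) powr (\<alpha> - 1) = inverse (y - t)"
      using assms by (simp flip: powr_add) (simp add: inverse_eq_divide)
    ultimately show ?thesis
      using True assms by (simp add: powr_mult ac_simps)
  next
    case False
    then have "t + (y - t) * s \<notin> {t..y}"
      using assms mult_less_cancel_left_pos[of "y - t" 1 s]
        mult_less_cancel_left_pos[of "y - t" s 0] by (auto simp: not_le algebra_simps)
    with False show ?thesis by simp
  qed
  have "has_bochner_integral lborel (\<lambda>s. ?F (t + (y - t) * s))
          (inverse (y - t) * Beta \<alpha> (1 - \<alpha>))"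
    unfolding eq
    by (intro has_bochner_integral_mult_right has_bochner_integral_Beta) (use assms in auto)
  then show ?thesis
    using assms by (subst lborel_has_bochner_integral_real_affine_iff[of "y - t" _ _ t]) auto
qed

text \<open>
  This is the Beta integrand with first parameter \<open>1\<close>, except at \<open>s = 0\<close>, where
  \<open>0 powr 0 = 0\<close>.
\<close>

lemma set_integrable_unit_weight:
  fixes \<alpha> :: real
  assumes "0 < \<alpha>"
  shows "set_integrable lborel {0..1} (\<lambda>s. (1 - s) powr (\<alpha> - 1))"
proof -
  have "set_integrable lborel {0..1} (\<lambda>s. s powr (1 - 1) * (1 - s) powr (\<alpha> - 1))"
    using has_bochner_integral_Beta[of 1 \<alpha>] assms
    by (simp add: set_integrable_def has_bochner_integral_iff)
  moreover have "AE s\<in>{0..1} in lborel.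
      s powr (1 - 1) * (1 - s) powr (\<alpha> - 1) = (1 - s) powr (\<alpha> - 1)"
    using AE_lborel_singleton[of "0::real"] by eventually_elim auto
  ultimately show ?thesis
    by (subst (asm) set_integrable_cong_AE) auto
qed

section \<open>Injectivity of the one-dimensional Abel operator\<close>

text \<open>
  Abel's inversion: composing with the integral of order \<open>1 - \<alpha>\<close> turns the hypothesis into the
  vanishing of the primitive of \<open>g\<close>. The double integral converges absolutely because \<open>g\<close> is
  integrable and the integral of the two kernels over \<open>x\<close> is the same for every \<open>t\<close>.
\<close>

lemma Abel_operator_injective:
  fixes g :: "real \<Rightarrow> real" and \<alpha> B :: real
  assumes \<alpha>: "0 < \<alpha>" "\<alpha> < 1" and "0 < B"
    and g: "continuous_on {0..B} g"
    and zero: "\<And>x. x \<in> {0..B} \<Longrightarrow>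
                 (LINT t:{0..x}|lborel. (x - t) powr (\<alpha> - 1) * g t) = 0"
    and t: "t \<in> {0..B}"
  shows "g t = 0"
proof -
  define g' where "g' s = indicator {0..B} s * g s" for s
  have g'_meas [measurable]: "g' \<in> borel_measurable borel"
    using borel_measurable_continuous_on_indicator[OF _ g] by (simp add: g'_def[abs_def])
  have primitive_zero: "integral {0..y} g = 0" if y: "y \<in> {0..B}" for y
  proof -
    let ?ker = "\<lambda>s x. indicator {s..y} x * ((y - x) powr (-\<alpha>) * (x - s) powr (\<alpha> - 1))"
    \<comment> \<open>At \<open>s = y\<close> the kernel degenerates, hence the half-open interval.\<close>
    define f where "f s x = (indicator {0..<y} s * g' s) * ?ker s x" for s x
    \<comment> \<open>Joint measurability is visible once the indicator of \<open>{s..y}\<close> is written as a condition on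
       the pair \<open>(s, x)\<close>.\<close>
    have f_eq: "f = (\<lambda>s x. (indicator {0..<y} s * g' s) *
        ((if s \<le> x \<and> x \<le> y then 1 else 0) * ((y - x) powr (-\<alpha>) * (x - s) powr (\<alpha> - 1))))"
      by (auto simp: f_def fun_eq_iff)
    have kernel: "has_bochner_integral lborel (?ker s) (Beta \<alpha> (1 - \<alpha>))" if "s < y" for s
      by (rule has_bochner_integral_Abel_kernels[OF \<alpha> that])
    have inner: "has_bochner_integral lborel (f s) (indicator {0..<y} s * g' s * Beta \<alpha> (1 - \<alpha>))"
      for s
    proof (cases "s < y")
      case True
      then show ?thesis
        unfolding f_def[abs_def] by (intro has_bochner_integral_mult_right kernel)
    qed (simp add: f_def[abs_def] has_bochner_integral_iff)
    have "has_bochner_integral lborel (\<lambda>x. \<bar>f s x\<bar>)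
        (\<bar>indicator {0..<y} s * g' s\<bar> * Beta \<alpha> (1 - \<alpha>))" for s
    proof (cases "s < y")
      case True
      then have "has_bochner_integral lborel (\<lambda>x. \<bar>indicator {0..<y} s * g' s\<bar> * ?ker s x)
          (\<bar>indicator {0..<y} s * g' s\<bar> * Beta \<alpha> (1 - \<alpha>))"
        by (intro has_bochner_integral_mult_right kernel)
      then show ?thesis by (simp add: f_def abs_mult)
    qed (simp add: f_def has_bochner_integral_iff)
    then have inner_abs:
      "(LINT x|lborel. \<bar>f s x\<bar>) = \<bar>indicator {0..<y} s * g' s\<bar> * Beta \<alpha> (1 - \<alpha>)" for s
      by (simp add: has_bochner_integral_iff)
    have g_int: "set_integrable lborel {0..y} g"
      using borel_integrable_atLeastAtMost'[of 0 y g] continuous_on_subset[OF g, of "{0..y}"] y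
      by auto
    have g_eq: "AE s in lborel. indicator {0..<y} s * g' s = indicator {0..y} s *\<^sub>R g s"
      using AE_lborel_singleton[of y] by eventually_elim (use y in \<open>auto simp: g'_def indicator_def\<close>)
    have g'_int: "integrable lborel (\<lambda>s. indicator {0..<y} s * g' s)"
      using g_int unfolding set_integrable_def
      by (subst integrable_cong_AE[OF _ _ g_eq]) (auto dest: borel_measurable_integrable)
    have f_meas: "case_prod f \<in> borel_measurable (lborel \<Otimes>\<^sub>M lborel)"
      unfolding f_eq by measurable
    have "integrable (lborel \<Otimes>\<^sub>M lborel) (case_prod f)"
    proof (rule lborel_pair.Fubini_integrable[OF f_meas])
      show "integrable lborel (\<lambda>s. LINT x|lborel. norm (case_prod f (s, x)))"
        using integrable_abs[OF g'_int] by (simp add: inner_abs)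
      show "AE s in lborel. integrable lborel (\<lambda>x. case_prod f (s, x))"
        using inner by (simp add: has_bochner_integral_iff)
    qed
    from lborel_pair.Fubini_integral[OF this]
    have swap: "(LINT x|lborel. LINT s|lborel. f s x) = (LINT s|lborel. LINT x|lborel. f s x)" .
    have outer: "(LINT s|lborel. f s x) = 0" for x
    proof (cases "x \<in> {0..y}")
      case True
      have "f s x = (y - x) powr (-\<alpha>) * (indicator {0..x} s *\<^sub>R ((x - s) powr (\<alpha> - 1) * g s))" for s
        using True y by (auto simp: f_def g'_def indicator_def)
      then have "(LINT s|lborel. f s x)
          = (y - x) powr (-\<alpha>) * (LINT s:{0..x}|lborel. (x - s) powr (\<alpha> - 1) * g s)"
        by (simp only: integral_mult_right_zero set_lebesgue_integral_def)
      with True y show ?thesis by (subst (asm) zero) auto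
    next
      case False
      then have "f s x = 0" for s by (auto simp: f_def indicator_def)
      then show ?thesis by simp
    qed
    have "(LINT s|lborel. indicator {0..<y} s * g' s * Beta \<alpha> (1 - \<alpha>)) = 0"
      using swap inner by (simp add: outer has_bochner_integral_iff)
    moreover have "Beta \<alpha> (1 - \<alpha>) \<noteq> 0"
      using \<alpha> by (simp add: Beta_def Gamma_real_pos less_imp_neq[THEN not_sym])
    ultimately have "(LINT s|lborel. indicator {0..<y} s * g' s) = 0"
      by simp
    moreover have "(LINT s|lborel. indicator {0..<y} s * g' s) = (LINT s:{0..y}|lborel. g s)"
      unfolding set_lebesgue_integral_def
      using g'_int g_int by (intro integral_cong_AE g_eq)
        (auto dest: borel_measurable_integrable simp: set_integrable_def)
    ultimately show ?thesis
      using set_borel_integral_eq_integral(2)[OF g_int] by simp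
  qed
  have "((\<lambda>y. integral {0..y} g) has_real_derivative g t) (at t within {0..B})"
    by (rule integral_has_real_derivative[OF g t])
  then have "((\<lambda>y. 0) has_real_derivative g t) (at t within {0..B})"
    by (rule has_field_derivative_transform_within[OF _ zero_less_one t]) (simp add: primitive_zero)
  moreover have "((\<lambda>y. 0::real) has_real_derivative 0) (at t within {0..B})" by simp
  moreover have "at t within {0..B} \<noteq> bot"
    using t \<open>0 < B\<close> by (simp add: trivial_limit_within islimpt_Icc)
  ultimately show ?thesis
    using has_field_derivative_unique by blast
qed

section \<open>Integrals with an integrable weight\<close>

lemma set_integrable_weight_mult_continuous:
  fixes k g :: "real \<Rightarrow> real"
  assumes k: "set_integrable lborel {0..1} k" and g: "continuous_on {0..1} g"
  shows "set_integrable lborel {0..1} (\<lambda>s. k s * g s)"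
proof -
  obtain M where M: "\<And>s. s \<in> {0..1} \<Longrightarrow> \<bar>g s\<bar> \<le> M"
    using compact_imp_bounded[OF compact_continuous_image[OF g compact_Icc]]
    unfolding bounded_iff by (metis image_eqI real_norm_def)
  have "set_borel_measurable lborel {0..1} (\<lambda>s. k s * g s)"
  proof -
    have "(\<lambda>s. (indicator {0..1} s *\<^sub>R k s) * (indicator {0..1} s *\<^sub>R g s)) \<in> borel_measurable lborel"
      using k borel_measurable_continuous_on_indicator[OF _ g]
      by (intro borel_measurable_times) (auto simp: set_integrable_def dest: borel_measurable_integrable)
    also have "(\<lambda>s. (indicator {0..1} s *\<^sub>R k s) * (indicator {0..1} s *\<^sub>R g s))
        = (\<lambda>s. indicator {0..1} s *\<^sub>R (k s * g s))"
      by (auto simp: indicator_def)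
    finally show ?thesis by (simp add: set_borel_measurable_def)
  qed
  moreover have "\<bar>k s * g s\<bar> \<le> \<bar>M * k s\<bar>" if "s \<in> {0..1}" for s
    using mult_left_mono[OF M[OF that], of "\<bar>k s\<bar>"] abs_ge_self[of M]
      mult_right_mono[of M "\<bar>M\<bar>" "\<bar>k s\<bar>"] by (auto simp: abs_mult mult.commute)
  ultimately show ?thesis
    using set_integrable_bound[OF set_integrable_mult_right[OF k, of M], of "\<lambda>s. k s * g s"]
    by auto
qed

text \<open>
  Dominated convergence: \<open>F\<close> is bounded by some \<open>M\<close> on the compact set \<open>U \<times> [0, 1]\<close>, so
  \<open>M \<bar>k\<bar>\<close> dominates every integrand.
\<close>

lemma continuous_on_weighted_integral:
  fixes k :: "real \<Rightarrow> real" and F :: "'a::metric_space \<Rightarrow> real \<Rightarrow> real"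
  assumes "compact U" and k: "set_integrable lborel {0..1} k"
    and F: "continuous_on (U \<times> {0..1}) (\<lambda>(x, s). F x s)"
  shows "continuous_on U (\<lambda>x. LINT s:{0..1}|lborel. k s * F x s)"
proof -
  obtain M where M: "\<And>x s. x \<in> U \<Longrightarrow> s \<in> {0..1} \<Longrightarrow> \<bar>F x s\<bar> \<le> M"
    using compact_imp_bounded[OF compact_continuous_image[OF F compact_Times[OF \<open>compact U\<close> compact_Icc]]]
    by (fastforce simp: bounded_iff)
  have int: "set_integrable lborel {0..1} (\<lambda>s. k s * F x s)" if "x \<in> U" for x
    using that by (intro set_integrable_weight_mult_continuous k
        continuous_on_compose2[OF F, of "{0..1}" "\<lambda>s. (x, s)", simplified] continuous_intros) auto
  have Fx: "continuous_on U (\<lambda>x. F x s)" if "s \<in> {0..1}" for s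
    using that by (intro continuous_on_compose2[OF F, of U "\<lambda>x. (x, s)", simplified]
        continuous_intros) auto
  show ?thesis
    unfolding continuous_on_sequentially
  proof (intro allI ballI impI, elim conjE)
    fix u a assume a: "a \<in> U" and u: "\<forall>n. u n \<in> U" and lim: "u \<longlonglongrightarrow> a"
    have "(\<lambda>n. LINT s|lborel. indicator {0..1} s *\<^sub>R (k s * F (u n) s))
        \<longlonglongrightarrow> (LINT s|lborel. indicator {0..1} s *\<^sub>R (k s * F a s))"
    proof (rule integral_dominated_convergence[where w = "\<lambda>s. \<bar>M * (indicator {0..1} s *\<^sub>R k s)\<bar>"])
      show "integrable lborel (\<lambda>s. \<bar>M * (indicator {0..1} s *\<^sub>R k s)\<bar>)"
        using k by (auto simp: set_integrable_def)
      show "AE s in lborel. (\<lambda>n. indicator {0..1} s *\<^sub>R (k s * F (u n) s))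
          \<longlonglongrightarrow> indicator {0..1} s *\<^sub>R (k s * F a s)"
      proof (rule AE_I2)
        fix s :: real
        show "(\<lambda>n. indicator {0..1} s *\<^sub>R (k s * F (u n) s))
          \<longlonglongrightarrow> indicator {0..1} s *\<^sub>R (k s * F a s)"
          using Fx[of s] a u lim
          by (cases "s \<in> {0..1}")
            (auto simp: continuous_on_sequentially o_def intro!: tendsto_mult)
      qed
      show "AE s in lborel. norm (indicator {0..1} s *\<^sub>R (k s * F (u n) s))
          \<le> \<bar>M * (indicator {0..1} s *\<^sub>R k s)\<bar>" for n
      proof (rule AE_I2)
        fix s :: real
        show "norm (indicator {0..1} s *\<^sub>R (k s * F (u n) s)) \<le> \<bar>M * (indicator {0..1} s *\<^sub>R k s)\<bar>"
        proof (cases "s \<in> {0..1}")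
          case True
          then have "\<bar>F (u n) s\<bar> \<le> \<bar>M\<bar>" using M[of "u n" s] u by force
          then show ?thesis
            using True by (simp add: abs_mult mult.commute[of "\<bar>M\<bar>"] mult_left_mono)
        qed simp
      qed
    qed (use int a u in \<open>auto simp: set_integrable_def dest: borel_measurable_integrable\<close>)
    then show "((\<lambda>x. LINT s:{0..1}|lborel. k s * F x s) \<circ> u)
        \<longlonglongrightarrow> (LINT s:{0..1}|lborel. k s * F a s)"
      by (simp add: set_lebesgue_integral_def o_def)
  qed
qed

section \<open>The Riemann--Liouville operator on a rectangle\<close>

abbreviation coord_upd :: "real ^ 'd \<Rightarrow> 'd \<Rightarrow> real \<Rightarrow> real ^ 'd" where
  "coord_upd x i t \<equiv> (\<chi> j. if j = i then t else x $ j)"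

lemma coord_upd_in_cbox:
  assumes "x \<in> cbox 0 b" "t \<in> {0..b $ i}"
  shows "coord_upd x i t \<in> cbox 0 b"
  using assms by (auto simp: mem_box_cart)

lemma coord_scaled_in_Icc:
  fixes x b :: "real ^ 'd"
  assumes "x \<in> cbox 0 b" "s \<in> {0..1}"
  shows "x $ i * s \<in> {0..b $ i}"
proof -
  have x: "0 \<le> x $ i" "x $ i \<le> b $ i" using assms by (auto simp: mem_box_cart)
  then show ?thesis using assms mult_left_le[of s "x $ i"] by auto
qed

lemma continuous_on_coord_scaled:
  fixes b :: "real ^ 'd"
  assumes "h \<in> cont_fun (cbox 0 b)"
  shows "continuous_on (cbox 0 b \<times> {0..1}) (\<lambda>(x, s). h (coord_upd x i (x $ i * s)))"
  unfolding case_prod_unfold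
proof (rule continuous_on_compose2[of "cbox 0 b" h])
  show "continuous_on (cbox 0 b) h" using assms by (simp add: cont_fun_def)
  show "continuous_on (cbox 0 b \<times> {0..1})
      (\<lambda>z. coord_upd (fst z) i (fst z $ i * snd z) :: real ^ 'd)"
  proof (rule continuous_on_vec_lambda)
    fix j
    show "continuous_on (cbox 0 b \<times> {0..1})
        (\<lambda>z. if j = i then fst z $ i * snd z else fst z $ j)"
      by (cases "j = i") (auto intro!: continuous_intros)
  qed
qed (auto intro!: coord_upd_in_cbox coord_scaled_in_Icc simp del: atLeastAtMost_iff simp: mem_Times_iff)

lemma continuous_on_coord_line:
  assumes "h \<in> cont_fun (cbox 0 b)" "x \<in> cbox 0 b"
  shows "continuous_on {0..b $ i} (\<lambda>t. h (coord_upd x i t))"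
proof (rule continuous_on_compose2[of "cbox 0 b" h])
  show "continuous_on (cbox 0 b) h" using assms by (simp add: cont_fun_def)
  show "continuous_on {0..b $ i} (\<lambda>t. coord_upd x i t)"
  proof (rule continuous_on_vec_lambda)
    fix j
    show "continuous_on {0..b $ i} (\<lambda>t. if j = i then t else x $ j)"
      by (cases "j = i") (auto intro!: continuous_intros)
  qed
qed (use assms in \<open>auto intro!: coord_upd_in_cbox simp del: atLeastAtMost_iff\<close>)

lemma Abel_integral_rescale:
  fixes g :: "real \<Rightarrow> real"
  assumes "0 \<le> T"
  shows "(LINT \<xi>:{0..T}|lborel. (T - \<xi>) powr (\<alpha> - 1) * g \<xi>)
       = T powr \<alpha> * (LINT s:{0..1}|lborel. (1 - s) powr (\<alpha> - 1) * g (T * s))"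
proof (cases "T = 0")
  case True
  \<comment> \<open>The only point of \<open>{0..T}\<close> is \<open>0\<close>, where \<open>0 powr (\<alpha> - 1) = 0\<close>.\<close>
  then have "indicator {0..T} \<xi> *\<^sub>R ((T - \<xi>) powr (\<alpha> - 1) * g \<xi>) = 0" for \<xi>
    by (auto simp: indicator_def)
  with True show ?thesis
    by (simp only: set_lebesgue_integral_def) simp
next
  case False
  with assms have T: "0 < T" by simp
  have eq: "indicator {0..T} (0 + T * s) *\<^sub>R ((T - (0 + T * s)) powr (\<alpha> - 1) * g (0 + T * s))
      = T powr (\<alpha> - 1) * (indicator {0..1} s *\<^sub>R ((1 - s) powr (\<alpha> - 1) * g (T * s)))" for s
  proof (cases "s \<in> {0..1}")
    case True
    moreover have "T - T * s = T * (1 - s)" by (simp add: algebra_simps)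
    ultimately show ?thesis
      using T mult_left_le[of s T] by (simp add: powr_mult)
  next
    case False
    then show ?thesis
      using T by (auto simp: indicator_def zero_le_mult_iff)
  qed
  have "(LINT \<xi>:{0..T}|lborel. (T - \<xi>) powr (\<alpha> - 1) * g \<xi>)
      = T * (T powr (\<alpha> - 1) * (LINT s:{0..1}|lborel. (1 - s) powr (\<alpha> - 1) * g (T * s)))"
    unfolding set_lebesgue_integral_def
    using T by (subst lborel_integral_real_affine[of T _ 0])
      (simp_all only: eq integral_mult_right_zero, simp_all)
  also have "T * (T powr (\<alpha> - 1) * (LINT s:{0..1}|lborel. (1 - s) powr (\<alpha> - 1) * g (T * s)))
      = T powr \<alpha> * (LINT s:{0..1}|lborel. (1 - s) powr (\<alpha> - 1) * g (T * s))"
    using T by (simp add: powr_diff)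
  finally show ?thesis .
qed

lemma RL_integral_rescale:
  fixes x b :: "real ^ 'd"
  assumes "x \<in> cbox 0 b"
  shows "RL_integral \<alpha> b i h x = 1 / Gamma \<alpha> * (x $ i powr \<alpha> *
           (LINT s:{0..1}|lborel. (1 - s) powr (\<alpha> - 1) * h (coord_upd x i (x $ i * s))))"
proof -
  have "0 \<le> x $ i" using assms by (auto simp: mem_box_cart)
  from Abel_integral_rescale[OF this, of \<alpha> "\<lambda>t. h (coord_upd x i t)"] assms show ?thesis
    by (simp add: RL_integral_def)
qed

lemma RL_integral_in_cont_fun:
  assumes "0 < \<alpha>" and h: "h \<in> cont_fun (cbox 0 b)"
  shows "RL_integral \<alpha> b i h \<in> cont_fun (cbox 0 b)"
proof -
  have "continuous_on (cbox 0 b) (\<lambda>x. LINT s:{0..1}|lborel.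
          (1 - s) powr (\<alpha> - 1) * h (coord_upd x i (x $ i * s)))"
    by (intro continuous_on_weighted_integral compact_cbox set_integrable_unit_weight
        \<open>0 < \<alpha>\<close> continuous_on_coord_scaled h)
  moreover have "continuous_on (cbox 0 b) (\<lambda>x. x $ i powr \<alpha>)"
    using \<open>0 < \<alpha>\<close> by (intro continuous_on_powr' continuous_intros) (auto simp: mem_box_cart)
  ultimately have "continuous_on (cbox 0 b) (RL_integral \<alpha> b i h)"
    by (subst continuous_on_cong[OF refl RL_integral_rescale]) (use Gamma_real_pos[OF \<open>0 < \<alpha>\<close>] in \<open>auto intro!: continuous_intros\<close>)
  then show ?thesis by (simp add: cont_fun_def RL_integral_def)
qed

lemma cont_fun_linear_combination:
  assumes "h \<in> cont_fun U" "k \<in> cont_fun U"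
  shows "(\<lambda>x. c * h x + d * k x) \<in> cont_fun U"
  using assms by (auto simp: cont_fun_def intro!: continuous_intros)

lemma RL_integral_linear_combination:
  assumes "0 < \<alpha>" and h: "h \<in> cont_fun (cbox 0 b)" and k: "k \<in> cont_fun (cbox 0 b)"
  shows "RL_integral \<alpha> b i (\<lambda>x. c * h x + d * k x)
       = (\<lambda>x. c * RL_integral \<alpha> b i h x + d * RL_integral \<alpha> b i k x)"
proof
  fix x
  show "RL_integral \<alpha> b i (\<lambda>x. c * h x + d * k x) x
      = c * RL_integral \<alpha> b i h x + d * RL_integral \<alpha> b i k x"
  proof (cases "x \<in> cbox 0 b")
    case True
    let ?w = "\<lambda>s::real. (1 - s) powr (\<alpha> - 1)"
    have int: "set_integrable lborel {0..1} (\<lambda>s. ?w s * f (coord_upd x i (x $ i * s)))"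
      if "f \<in> cont_fun (cbox 0 b)" for f
      using True
      by (intro set_integrable_weight_mult_continuous set_integrable_unit_weight \<open>0 < \<alpha>\<close>
          continuous_on_compose2[OF continuous_on_coord_scaled[OF that], of "{0..1}"
            "\<lambda>s. (x, s)", simplified] continuous_intros) auto
    have "(LINT s:{0..1}|lborel. ?w s * (c * h (coord_upd x i (x $ i * s))
              + d * k (coord_upd x i (x $ i * s))))
        = (LINT s:{0..1}|lborel. c * (?w s * h (coord_upd x i (x $ i * s)))
              + d * (?w s * k (coord_upd x i (x $ i * s))))"
      by (simp add: algebra_simps)
    also have "\<dots> = c * (LINT s:{0..1}|lborel. ?w s * h (coord_upd x i (x $ i * s)))
              + d * (LINT s:{0..1}|lborel. ?w s * k (coord_upd x i (x $ i * s)))"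
      using int[OF h] int[OF k] by (simp add: set_integral_add)
    finally show ?thesis
      using True by (simp add: RL_integral_rescale algebra_simps)
  qed (simp add: RL_integral_def)
qed

text \<open>
  By linearity it suffices to treat a function with vanishing integral; on each line parallel to
  the \<open>i\<close>-th axis this is the one-dimensional statement.
\<close>

lemma RL_integral_inj_on:
  fixes b :: "real ^ 'd"
  assumes \<alpha>: "0 < \<alpha>" "\<alpha> < 1" and b: "0 < b $ i"
  shows "inj_on (RL_integral \<alpha> b i) (cont_fun (cbox 0 b))"
proof (rule inj_onI, rule ext)
  fix h k x
  assume h: "h \<in> cont_fun (cbox 0 b)" and k: "k \<in> cont_fun (cbox 0 b)"
    and eq: "RL_integral \<alpha> b i h = RL_integral \<alpha> b i k"
  define f where "f = (\<lambda>x. 1 * h x + (- 1) * k x)"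
  have f: "f \<in> cont_fun (cbox 0 b)"
    unfolding f_def by (rule cont_fun_linear_combination[OF h k])
  have f0: "RL_integral \<alpha> b i f y = 0" for y
    unfolding f_def RL_integral_linear_combination[OF \<alpha>(1) h k] by (simp add: eq)
  show "h x = k x"
  proof (cases "x \<in> cbox 0 b")
    case True
    then have xi: "x $ i \<in> {0..b $ i}" by (auto simp: mem_box_cart)
    have "f (coord_upd x i (x $ i)) = 0"
    proof (rule Abel_operator_injective[OF \<alpha> b continuous_on_coord_line[OF f True] _ xi])
      fix t assume t: "t \<in> {0..b $ i}"
      have upd_upd: "coord_upd (coord_upd x i t) i u = coord_upd x i u" for u
        by (simp add: vec_eq_iff)
      show "(LINT u:{0..t}|lborel. (t - u) powr (\<alpha> - 1) * f (coord_upd x i u)) = 0"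
        using f0[of "coord_upd x i t"] coord_upd_in_cbox[OF True t] Gamma_real_pos[OF \<alpha>(1)]
        by (simp add: RL_integral_def upd_upd)
    qed
    moreover have "coord_upd x i (x $ i) = x" by (simp add: vec_eq_iff)
    ultimately show ?thesis by (simp add: f_def)
  next
    case False
    with h k show ?thesis by (simp add: cont_fun_def)
  qed
qed

lemma caputo_RL_integral:
  assumes "0 < \<alpha>" "\<alpha> < 1" "0 < b $ i" "h \<in> cont_fun (cbox 0 b)"
  shows "caputo \<alpha> b i (RL_integral \<alpha> b i h) = h"
  unfolding caputo_def
  using assms RL_integral_inj_on[of \<alpha> b i] by (intro the_equality) (auto dest: inj_onD)

lemma frac_space_eq_image:
  assumes "0 < \<alpha>"
  shows "frac_space \<alpha> b i = RL_integral \<alpha> b i ` cont_fun (cbox 0 b)"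
  using RL_integral_in_cont_fun[OF assms] by (auto simp: frac_space_def)

section \<open>Normalized fractional derivations\<close>

lemma frac_scalar_eqI:
  assumes p: "p \<in> cbox 0 b"
    and c: "\<And>h. h \<in> cont_fun (cbox 0 b) \<Longrightarrow> D (RL_integral \<alpha> b i h) = c * h p"
  shows "frac_scalar \<alpha> b i p D = c"
  unfolding frac_scalar_def
proof (rule the_equality)
  fix c' assume c': "\<forall>h\<in>cont_fun (cbox 0 b). D (RL_integral \<alpha> b i h) = c' * h p"
  have one: "indicator (cbox 0 b) \<in> cont_fun (cbox 0 b)"
    using continuous_on_cong[of "cbox 0 b" "cbox 0 b" "indicator (cbox 0 b)" "\<lambda>_. 1::real"]
    by (auto simp: cont_fun_def)
  from c'[rule_format, OF one] c[OF one] p show "c' = c" by simp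
qed (use c in blast)

lemma normalized_frac_derivation_RL_integral:
  assumes "p \<in> cbox 0 b" "normalized_frac_derivation \<alpha> b i p D" "h \<in> cont_fun (cbox 0 b)"
  shows "D (RL_integral \<alpha> b i h) = h p"
proof -
  obtain c where c: "\<And>h. h \<in> cont_fun (cbox 0 b) \<Longrightarrow> D (RL_integral \<alpha> b i h) = c * h p"
    using assms(2) by (auto simp: normalized_frac_derivation_def frac_derivation_def)
  moreover have "c = 1"
    using frac_scalar_eqI[OF assms(1) c] assms(2) by (simp add: normalized_frac_derivation_def)
  ultimately show ?thesis using assms(3) by simp
qed

lemma normalized_frac_derivation_caputo:
  fixes b p :: "real ^ 'd"
  assumes \<alpha>: "0 < \<alpha>" "\<alpha> < 1" and b: "0 < b $ i" and p: "p \<in> cbox 0 b"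
  shows "normalized_frac_derivation \<alpha> b i p (\<lambda>f\<in>frac_space \<alpha> b i. caputo \<alpha> b i f p)"
    (is "normalized_frac_derivation _ _ _ _ ?C")
proof -
  let ?I = "RL_integral \<alpha> b i"
  have space: "frac_space \<alpha> b i = ?I ` cont_fun (cbox 0 b)"
    by (rule frac_space_eq_image[OF \<alpha>(1)])
  have C: "?C (?I h) = h p" if "h \<in> cont_fun (cbox 0 b)" for h
    using that by (simp add: space caputo_RL_integral[OF \<alpha> b])
  have C_lin: "?C (\<lambda>x. c * ?I h x + d * ?I k x) = c * h p + d * k p"
    if "h \<in> cont_fun (cbox 0 b)" "k \<in> cont_fun (cbox 0 b)" for h k c d
    using C[OF cont_fun_linear_combination[OF that]]
    by (simp only: RL_integral_linear_combination[OF \<alpha>(1) that])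
  have "linear_functional_on (frac_space \<alpha> b i) ?C"
    unfolding linear_functional_on_def
  proof (intro conjI ballI allI)
    show "?C \<in> extensional (frac_space \<alpha> b i)" by (rule restrict_extensional)
  next
    fix f g assume "f \<in> frac_space \<alpha> b i" "g \<in> frac_space \<alpha> b i"
    then obtain h k where "h \<in> cont_fun (cbox 0 b)" "f = ?I h" "k \<in> cont_fun (cbox 0 b)" "g = ?I k"
      by (auto simp: space)
    then show "?C (\<lambda>x. f x + g x) = ?C f + ?C g"
      using C_lin[of h k 1 1] C[of h] C[of k] by (simp only: mult_1)
  next
    fix c f assume "f \<in> frac_space \<alpha> b i"
    then obtain h where "h \<in> cont_fun (cbox 0 b)" "f = ?I h"
      by (auto simp: space)
    then show "?C (\<lambda>x. c * f x) = c * ?C f"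
      using C_lin[of h h c 0] C[of h] by (simp only: mult_zero_left add_0_right)
  qed
  moreover have "\<exists>c. \<forall>h\<in>cont_fun (cbox 0 b). ?C (?I h) = c * h p"
    by (rule exI[of _ 1]) (use C in \<open>auto simp del: restrict_apply\<close>)
  moreover have "frac_scalar \<alpha> b i p ?C = 1"
    by (rule frac_scalar_eqI[OF p]) (simp only: C mult_1)
  ultimately show ?thesis
    unfolding normalized_frac_derivation_def frac_derivation_def by blast
qed

theorem corollary3p4:
  fixes \<alpha> :: real and b p :: "real ^ 'd" and i :: 'd
  assumes "0 < \<alpha>" and "\<alpha> < 1"
    and "\<And>j. 0 < b $ j"
    and "p \<in> cbox 0 b"
  shows "normalized_frac_derivation \<alpha> b i p (\<lambda>f\<in>frac_space \<alpha> b i. caputo \<alpha> b i f p) \<and>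
         (\<forall>D. normalized_frac_derivation \<alpha> b i p D \<longrightarrow>
              D = (\<lambda>f\<in>frac_space \<alpha> b i. caputo \<alpha> b i f p))"
proof (intro conjI allI impI)
  show caputo: "normalized_frac_derivation \<alpha> b i p (\<lambda>f\<in>frac_space \<alpha> b i. caputo \<alpha> b i f p)"
    using assms by (intro normalized_frac_derivation_caputo)
  fix D assume D: "normalized_frac_derivation \<alpha> b i p D"
  have "D \<in> extensional (frac_space \<alpha> b i)"
    using D by (simp add: normalized_frac_derivation_def frac_derivation_def linear_functional_on_def)
  then show "D = (\<lambda>f\<in>frac_space \<alpha> b i. caputo \<alpha> b i f p)"
  proof (rule extensionalityI[OF _ restrict_extensional])
    fix f assume "f \<in> frac_space \<alpha> b i"
    then obtain h where "h \<in> cont_fun (cbox 0 b)" "f = RL_integral \<alpha> b i h"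
      by (auto simp: frac_space_eq_image[OF \<open>0 < \<alpha>\<close>])
    then show "D f = (\<lambda>f\<in>frac_space \<alpha> b i. caputo \<alpha> b i f p) f"
      using normalized_frac_derivation_RL_integral[OF \<open>p \<in> cbox 0 b\<close>] D caputo by metis
  qed
qed

end
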